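(* Let $\mathbb{F}=\mathbb{R}$ or $\mathbb{C}$ and let $n,p$ be integers with $2\le p\le n-2$. Every Plücker-like equation is a sum/subtraction of usual Plücker equations. That is, for every $\mathbf{j}\in\mathcal{I}^n_{p-2}$ and $\mathbf{k}\in\mathcal{I}^n_{p+2}$, the equation $\mathcal{Q}(\mathbf{j},\mathbf{k})=0$ coincides (up to a nonzero constant factor) with an equation of the form $\sum_{s=1}^{m}\varepsilon_s\,\mathcal{P}(\mathbf{j}_s,\mathbf{k}_s)=0$, for some $m\ge 1$, signs $\varepsilon_s\in\{1,-1\}$, and multi-indices $\mathbf{j}_s\in\mathcal{I}^n_{p-1}$, $\mathbf{k}_s\in\mathcal{I}^n_{p+1}$.
   Context: For integers $0\le r\le n$, $\mathcal{I}^n_r=\{(i_1,\ldots,i_r)\in\mathbb{N}^r: 1\le i_1<\cdots<i_r\le n\}$; its elements (multi-indices) are identified with the $r$-element subsets of $\{1,\ldots,n\}$. For multi-indices $\mathbf{i},\mathbf{j}$, the symbols $\mathbf{i}\cup\mathbf{j}$, $\mathbf{i}\setminus\mathbf{j}$, $\mathbf{i}\triangle\mathbf{j}$ denote the union, difference and symmetric difference, written in increasing order, and $|\mathbf{i}>\mathbf{j}|$ denotes the number of pairs $(i,j)$ with $i\in\mathbf{i}$, $j\in\mathbf{j}$ and $i>j$. A single index $i$ is identified with the multi-index $(i)$. Let $\lambda_{\mathbf{i}}$, $\mathbf{i}\in\mathcal{I}^n_p$, be variables over $\mathbb{F}$ (they stand for the coordinates of a $p$-vector $H=\sum_{\mathbf{i}\in\mathcal{I}^n_p}\lambda_{\mathbf{i}}\,v_{i_1}\wedge\cdots\wedge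 v_{i_p}\in\bigwedge^p\mathbb{F}^n$ in an orthonormal basis $(v_1,\ldots,v_n)$ of $\mathbb{F}^n$). Equations are regarded as formal homogeneous quadratic equations, with left-hand sides in the polynomial ring $\mathbb{F}[\lambda_{\mathbf{i}}:\mathbf{i}\in\mathcal{I}^n_p]$. The usual Plücker equations are $\mathcal{P}(\mathbf{j},\mathbf{k})=0$ for all $\mathbf{j}\in\mathcal{I}^n_{p-1}$, $\mathbf{k}\in\mathcal{I}^n_{p+1}$, where $$\mathcal{P}(\mathbf{j},\mathbf{k})=\sum_{i\in\mathbf{k}\setminus\mathbf{j}}(-1)^{|\mathbf{j}\triangle\mathbf{k}>i|}\,\lambda_{\mathbf{j}\cup i}\,\lambda_{\mathbf{k}\setminus i}.$$ The Plücker-like equations are $\mathcal{Q}(\mathbf{j},\mathbf{k})=0$ for all $\mathbf{j}\in\mathcal{I}^n_{p-2}$, $\mathbf{k}\in\mathcal{I}^n_{p+2}$, where $$\mathcal{Q}(\mathbf{j},\mathbf{k})=\sum_{\mathbf{i}\in\mathcal{I}^n_2,\ \mathbf{i}\subset\mathbf{k}\setminus\mathbf{j}}(-1)^{|\mathbf{j}\triangle\mathbf{k}>\mathbf{i}|}\,\lambda_{\mathbf{j}\cup\mathbf{i}}\,\lambda_{\mathbf{k}\setminus\mathbf{i}}.$$ *)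

theory Defs
  imports Complex_Main "HOL-Library.Poly_Mapping"
begin

text \<open>
  Multi-indices \<open>1 \<le> i\<^sub>1 < \<dots> < i\<^sub>r \<le> n\<close> are represented by the \<open>r\<close>-element subsets of
  \<open>{1..n}\<close>; union, difference and symmetric difference are then those of sets, and a single
  index \<open>i\<close> is the multi-index \<open>{i}\<close>.
\<close>

definition multi_indices :: "nat \<Rightarrow> nat \<Rightarrow> nat set set" where
  "multi_indices n r = {I. I \<subseteq> {1..n} \<and> card I = r}"

definition num_gt :: "nat set \<Rightarrow> nat set \<Rightarrow> nat" where
  "num_gt I J = card {(i, j). i \<in> I \<and> j \<in> J \<and> i > j}"

text \<open>
  Polynomials are finitely supported maps from monomials to coefficients, and monomials are
  finitely supported maps from variables to exponents. There is one variable \<open>lam I\<close> for every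
  \<open>I :: nat set\<close>, but only those with \<open>I \<in> multi_indices n p\<close> occur in the equations below, since
  the index sets on the right-hand sides then have cardinality \<open>p\<close>.
\<close>

type_synonym 'a lpoly = "(nat set \<Rightarrow>\<^sub>0 nat) \<Rightarrow>\<^sub>0 'a"

definition lam :: "nat set \<Rightarrow> 'a::comm_ring_1 lpoly" where
  "lam I = Poly_Mapping.single (Poly_Mapping.single I 1) 1"

definition const_poly :: "'a::comm_ring_1 \<Rightarrow> 'a lpoly" where
  "const_poly c = Poly_Mapping.single 0 c"

definition plucker :: "nat set \<Rightarrow> nat set \<Rightarrow> 'a::comm_ring_1 lpoly" where
  "plucker J K =
     (\<Sum>i\<in>K - J. (- 1) ^ num_gt (sym_diff J K) {i} * lam (J \<union> {i}) * lam (K - {i}))"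

definition plucker_like :: "nat \<Rightarrow> nat set \<Rightarrow> nat set \<Rightarrow> 'a::comm_ring_1 lpoly" where
  "plucker_like n J K =
     (\<Sum>I \<in> {I \<in> multi_indices n 2. I \<subseteq> K - J}.
        (- 1) ^ num_gt (sym_diff J K) I * lam (J \<union> I) * lam (K - I))"

end

theory Submission
  imports Defs
begin

text \<open>
  Moving an index \<open>a \<in> K - J\<close> from \<open>K\<close> to \<open>J\<close> does not change the symmetric difference
  \<open>D = sym_diff J K\<close>. Writing \<open>s i = (- 1) ^ num_gt D {i}\<close>, every equation \<open>plucker (J \<union> {a}) (K - {a})\<close>
  therefore carries the same signs \<open>s i\<close>, and its terms are
  \<open>s i * lam (J \<union> {a, i}) * lam (K - {a, i})\<close>, with exactly the monomials of \<open>plucker_like n J K\<close>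
  that belong to pairs containing \<open>a\<close>. Since \<open>num_gt D\<close> is additive on disjoint unions, the
  sign of the pair \<open>{a, i}\<close> in the Pluecker-like equation is \<open>s a * s i\<close>. Hence multiplying by
  \<open>s a\<close> and summing over \<open>a\<close> gives the correct sign to each term and meets every pair
  exactly twice, once from each of its elements:
  \<open>2 * plucker_like n J K = (\<Sum>a\<in>K - J. s a * plucker (J \<union> {a}) (K - {a}))\<close>.
  In characteristic zero this is the asserted combination, with constant \<open>c = 2\<close>; the sum has
  \<open>card (K - J) \<ge> card K - card J = 4\<close> terms.
\<close>

lemma num_gt_insert:
  assumes "finite I" "finite J" "b \<notin> J"
  shows "num_gt I (insert b J) = num_gt I {b} + num_gt I J"
proof -
  have fin: "finite {(i, j). i \<in> I \<and> j \<in> L \<and> i > j}" if "finite L" for L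
    by (rule finite_subset[of _ "I \<times> L"]) (use assms that in auto)
  have "{(i, j). i \<in> I \<and> j \<in> insert b J \<and> i > j} =
      {(i, j). i \<in> I \<and> j \<in> {b} \<and> i > j} \<union> {(i, j). i \<in> I \<and> j \<in> J \<and> i > j}"
    by auto
  moreover have "{(i, j). i \<in> I \<and> j \<in> {b} \<and> i > j} \<inter> {(i, j). i \<in> I \<and> j \<in> J \<and> i > j} = {}"
    using assms by auto
  ultimately show ?thesis
    unfolding num_gt_def using card_Un_disjoint[OF fin[of "{b}"] fin[of J]] assms(2) by simp
qed

lemma const_poly_sign: "const_poly ((- 1) ^ k) = (- 1) ^ k"
  by (cases "even k") (simp_all add: const_poly_def single_uminus)

lemma const_poly_2: "const_poly 2 = 2"
  by (simp add: const_poly_def)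

text \<open>
  Double counting: a two-element set arises from the ordered pairs \<open>(a, i)\<close> and \<open>(i, a)\<close>, so
  summing over the pairs containing a given \<open>a\<close> and then over \<open>a\<close> counts each one twice.
\<close>

lemma sum_ordered_pairs:
  fixes f :: "'b set \<Rightarrow> 'c::semiring_1"
  assumes "finite A"
  shows "(\<Sum>a\<in>A. \<Sum>i\<in>A - {a}. f {a, i}) = 2 * (\<Sum>I | I \<subseteq> A \<and> card I = 2. f I)"
proof -
  let ?T = "{I. I \<subseteq> A \<and> card I = 2}"
  have fin: "finite ?T"
    by (rule finite_subset[of _ "Pow A"]) (use assms in auto)
  have "(\<Sum>i\<in>A - {a}. f {a, i}) = (\<Sum>I | I \<in> ?T \<and> a \<in> I. f I)" if "a \<in> A" for a
  proof (rule sum.reindex_bij_betw)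
    show "bij_betw (\<lambda>i. {a, i}) (A - {a}) {I. I \<in> ?T \<and> a \<in> I}"
      unfolding bij_betw_def
    proof
      show "inj_on (\<lambda>i. {a, i}) (A - {a})"
        by (auto simp: inj_on_def doubleton_eq_iff)
      show "(\<lambda>i. {a, i}) ` (A - {a}) = {I. I \<in> ?T \<and> a \<in> I}"
        using that by (auto simp: card_2_iff)
    qed
  qed
  then have "(\<Sum>a\<in>A. \<Sum>i\<in>A - {a}. f {a, i}) = (\<Sum>a\<in>A. \<Sum>I | I \<in> ?T \<and> a \<in> I. f I)"
    by simp
  also have "\<dots> = (\<Sum>I\<in>?T. \<Sum>a | a \<in> A \<and> a \<in> I. f I)"
    by (rule sum.swap_restrict) (use assms fin in auto)
  also have "\<dots> = (\<Sum>I\<in>?T. 2 * f I)"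
  proof (rule sum.cong[OF refl])
    fix I assume I: "I \<in> ?T"
    then have "{a. a \<in> A \<and> a \<in> I} = I" by auto
    with I show "(\<Sum>a | a \<in> A \<and> a \<in> I. f I) = 2 * f I" by simp
  qed
  finally show ?thesis by (simp add: sum_distrib_left)
qed

lemma plucker_shift:
  assumes "a \<in> K - J"
  shows "plucker (J \<union> {a}) (K - {a}) =
    (\<Sum>i\<in>K - J - {a}. (- 1) ^ num_gt (sym_diff J K) {i} * lam (J \<union> {a, i}) * lam (K - {a, i}))"
proof -
  have "sym_diff (J \<union> {a}) (K - {a}) = sym_diff J K" "K - {a} - (J \<union> {a}) = K - J - {a}"
    using assms by auto
  moreover have "J \<union> {a} \<union> {i} = J \<union> {a, i}" "K - {a} - {i} = K - {a, i}" for i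
    by auto
  ultimately show ?thesis by (simp only: plucker_def)
qed

text \<open>
  The weight of the equation obtained by moving \<open>a\<close> is its own sign: it completes \<open>s i\<close> to the
  sign \<open>s a * s i\<close> of the pair, which is symmetric in \<open>a\<close> and \<open>i\<close>, so that the two
  occurrences of a pair add up rather than cancel.
\<close>

lemma two_plucker_like:
  assumes "finite J" "K \<subseteq> {1..n}"
  shows "2 * plucker_like n J K =
    (\<Sum>a\<in>K - J. (- 1) ^ num_gt (sym_diff J K) {a} * plucker (J \<union> {a}) (K - {a}))"
proof -
  let ?D = "sym_diff J K"
  define f where
    "f I = (- 1) ^ num_gt ?D I * lam (J \<union> I) * (lam (K - I) :: 'a lpoly)" for I
  have finK: "finite K" using assms(2) finite_subset by blast
  with assms(1) have finD: "finite ?D" by simp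
  have sign: "num_gt ?D {a, i} = num_gt ?D {a} + num_gt ?D {i}" if "a \<noteq> i" for a i
    using that finD by (simp add: num_gt_insert[of _ "{i}"])
  have "(- 1) ^ num_gt ?D {a} * plucker (J \<union> {a}) (K - {a}) = (\<Sum>i\<in>K - J - {a}. f {a, i})"
    if "a \<in> K - J" for a
    unfolding plucker_shift[OF that] sum_distrib_left
    by (rule sum.cong) (auto simp: f_def sign power_add mult.assoc)
  then have "(\<Sum>a\<in>K - J. (- 1) ^ num_gt ?D {a} * plucker (J \<union> {a}) (K - {a})) =
      (\<Sum>a\<in>K - J. \<Sum>i\<in>K - J - {a}. f {a, i})"
    by simp
  also have "\<dots> = 2 * (\<Sum>I | I \<subseteq> K - J \<and> card I = 2. f I)"
    by (rule sum_ordered_pairs) (use finK in simp)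
  also have "{I. I \<subseteq> K - J \<and> card I = 2} = {I \<in> multi_indices n 2. I \<subseteq> K - J}"
    using assms(2) by (auto simp: multi_indices_def)
  finally show ?thesis by (simp add: plucker_like_def f_def)
qed

lemma plucker_like_combination:
  assumes "2 \<le> p" "J \<in> multi_indices n (p - 2)" "K \<in> multi_indices n (p + 2)"
  shows "\<exists>(c::'a::{comm_ring_1, ring_char_0}) (m::nat) (\<epsilon>::nat \<Rightarrow> 'a)
        (Js::nat \<Rightarrow> nat set) (Ks::nat \<Rightarrow> nat set).
      c \<noteq> 0 \<and> m \<ge> 1 \<and>
      (\<forall>s\<in>{1..m}. \<epsilon> s \<in> {1, - 1} \<and>
         Js s \<in> multi_indices n (p - 1) \<and> Ks s \<in> multi_indices n (p + 1)) \<and>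
      const_poly c * plucker_like n J K =
        (\<Sum>s=1..m. const_poly (\<epsilon> s) * plucker (Js s) (Ks s))"
proof -
  have J: "J \<subseteq> {1..n}" "card J = p - 2" and K: "K \<subseteq> {1..n}" "card K = p + 2"
    using assms by (auto simp: multi_indices_def)
  have fin: "finite J" "finite K" using J(1) K(1) finite_subset by blast+
  let ?s = "\<lambda>a. num_gt (sym_diff J K) {a}" and ?m = "card (K - J)"
  obtain h where h: "bij_betw h {1..?m} (K - J)"
    using ex_bij_betw_nat_finite_1[of "K - J"] fin by auto
  have "?m \<ge> card K - card J" by (rule diff_card_le_card_Diff[OF fin(1)])
  then have m: "?m \<ge> 1" using J K assms(1) by simp
  have ind: "(- 1) ^ ?s (h t) \<in> {1, - 1 :: 'a} \<and>
      J \<union> {h t} \<in> multi_indices n (p - 1) \<and> K - {h t} \<in> multi_indices n (p + 1)"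
    if "t \<in> {1..?m}" for t
  proof -
    have "h t \<in> K - J" using h that bij_betwE by blast
    then show ?thesis
      using J K fin assms(1) by (cases "even (?s (h t))") (auto simp: multi_indices_def)
  qed
  have eq: "const_poly (2::'a) * plucker_like n J K =
      (\<Sum>t=1..?m. const_poly ((- 1) ^ ?s (h t)) * plucker (J \<union> {h t}) (K - {h t}))"
    unfolding const_poly_2 const_poly_sign two_plucker_like[OF fin(1) K(1)]
    by (rule sum.reindex_bij_betw[OF h, symmetric])
  show ?thesis
    by (rule exI[of _ 2], rule exI[of _ ?m], rule exI[of _ "\<lambda>t. (- 1) ^ ?s (h t)"],
        rule exI[of _ "\<lambda>t. J \<union> {h t}"], rule exI[of _ "\<lambda>t. K - {h t}"])
      (intro conjI ballI m eq; use ind in simp)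
qed

theorem proposition1:
  fixes n p :: nat and J K :: "nat set"
  assumes "2 \<le> p" and "p + 2 \<le> n"
    and "J \<in> multi_indices n (p - 2)" and "K \<in> multi_indices n (p + 2)"
  shows
    "(\<exists>(c::real) (m::nat) (\<epsilon>::nat \<Rightarrow> real) (Js::nat \<Rightarrow> nat set) (Ks::nat \<Rightarrow> nat set).
        c \<noteq> 0 \<and> m \<ge> 1 \<and>
        (\<forall>s\<in>{1..m}. \<epsilon> s \<in> {1, - 1} \<and>
           Js s \<in> multi_indices n (p - 1) \<and> Ks s \<in> multi_indices n (p + 1)) \<and>
        const_poly c * plucker_like n J K =
          (\<Sum>s=1..m. const_poly (\<epsilon> s) * plucker (Js s) (Ks s)))
     \<and>
     (\<exists>(c::complex) (m::nat) (\<epsilon>::nat \<Rightarrow> complex) (Js::nat \<Rightarrow> nat set) (Ks::nat \<Rightarrow> nat set).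
        c \<noteq> 0 \<and> m \<ge> 1 \<and>
        (\<forall>s\<in>{1..m}. \<epsilon> s \<in> {1, - 1} \<and>
           Js s \<in> multi_indices n (p - 1) \<and> Ks s \<in> multi_indices n (p + 1)) \<and>
        const_poly c * plucker_like n J K =
          (\<Sum>s=1..m. const_poly (\<epsilon> s) * plucker (Js s) (Ks s)))"
  by (intro conjI plucker_like_combination assms(1,3,4))

end
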